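(* There exists a universal constant $C>0$ such that the following holds. Let $\bar\rho\in L^1(\Pi^d)$ with $\bar\rho\ge0$ and $\int_{\Pi^d}\bar\rho\,dx=1$. Let $\phi(x,z)\in L^\infty$ be a scalar function on $\Pi^d\times\Pi^d$ with $$\gamma:=C\left(\sup_{p\ge1}\frac{\big\|\sup_z|\phi(\cdot,z)|\big\|_{L^p(\bar\rho\,dx)}}{p}\right)^2<1 .$$ Assume that $\phi$ satisfies the cancellations $$\int_{\Pi^d}\phi(x,z)\,\bar\rho(x)\,dx=0\quad\forall z,\qquad \int_{\Pi^d}\phi(x,z)\,\bar\rho(z)\,dz=0\quad\forall x .$$ Then, for every $N\ge1$, $$\int_{\Pi^{dN}}\bar\rho_N\exp\Big(\frac1N\sum_{i,j=1}^N\phi(x_i,x_j)\Big)\,dX^N\le\frac{2}{1-\gamma}<\infty ,$$ where $\bar\rho_N(X^N)=\prod_{i=1}^N\bar\rho(x_i)$.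
   Context: $\Pi^d$ is the $d$-dimensional torus; $X^N=(x_1,\dots,x_N)\in\Pi^{dN}$. $\phi$ is an everywhere-defined bounded measurable function (so that the diagonal terms $\phi(x_i,x_i)$ make sense); no continuity is assumed. $\|f\|_{L^p(\bar\rho\,dx)}=(\int_{\Pi^d}|f|^p\bar\rho\,dx)^{1/p}$. *)

theory Defs
  imports "HOL-Probability.Probability"
begin

quotient_type circle = real / "\<lambda>x y. \<exists>k::int. x = y + of_int k"
proof (rule equivpI)
  show "reflp (\<lambda>x y::real. \<exists>k::int. x = y + of_int k)"
    by (rule reflpI, rule exI[of _ 0]) simp
  show "symp (\<lambda>x y::real. \<exists>k::int. x = y + of_int k)"
  proof (rule sympI)
    fix x y :: real
    assume "\<exists>k::int. x = y + of_int k"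
    then obtain k :: int where "x = y + of_int k" ..
    then have "y = x + of_int (- k)" by simp
    then show "\<exists>k::int. y = x + of_int k" ..
  qed
  show "transp (\<lambda>x y::real. \<exists>k::int. x = y + of_int k)"
  proof (rule transpI)
    fix x y z :: real
    assume "\<exists>k::int. x = y + of_int k" "\<exists>k::int. y = z + of_int k"
    then obtain k l :: int where "x = y + of_int k" "y = z + of_int l" by blast
    then have "x = z + of_int (k + l)" by simp
    then show "\<exists>k::int. x = z + of_int k" ..
  qed
qed

instantiation circle :: topological_space
begin

definition open_circle :: "circle set \<Rightarrow> bool" where
  "open_circle U \<longleftrightarrow> open (abs_circle -` U)"

instance
  by standard (auto simp: open_circle_def vimage_Union)

end

lemma continuous_on_abs_circle: "continuous_on UNIV abs_circle"
  by (simp add: continuous_on_open_vimage open_circle_def)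

lemma measurable_abs_circle [measurable]: "abs_circle \<in> borel_measurable borel"
  by (rule borel_measurable_continuous_onI[OF continuous_on_abs_circle])

definition circle_measure :: "circle measure" where
  "circle_measure = distr (restrict_space lborel {0..<1}) borel abs_circle"

text \<open>
  The torus of dimension \<open>d\<close> with its Borel sets and its Lebesgue (Haar) measure.  The dimension
  is a natural number rather than a type because it has to be quantified inside the scope of a
  universal constant.
\<close>

definition torus :: "nat \<Rightarrow> (nat \<Rightarrow> circle) measure" where
  "torus d = Pi\<^sub>M {..<d} (\<lambda>_. circle_measure)"

text \<open>
  The norm is used for \<open>x \<mapsto> sup\<^sub>z \<bar>\<phi>(x,z)\<bar>\<close>.  For Borel measurable \<open>\<phi>\<close> this function is Lebesgue
  measurable but in general not Borel measurable, so that a Bochner integral over the Borel sets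
  would silently be \<open>0\<close>.  The nonnegative integral does not have this defect: it is the supremum of
  the integrals of the simple functions below the integrand, and hence it agrees with the integral
  over the completed measure (lemma \<open>nn_integral_completion\<close>).
  If the integral is infinite the value is \<open>0\<close>; the norm is meant for bounded \<open>f\<close> and finite \<open>M\<close>.
\<close>

definition Lp_norm :: "'a measure \<Rightarrow> real \<Rightarrow> ('a \<Rightarrow> real) \<Rightarrow> real" where
  "Lp_norm M p f = enn2real (\<integral>\<^sup>+ x. ennreal (\<bar>f x\<bar> powr p) \<partial>M) powr (1 / p)"

lemma space_circle_measure [simp]: "space circle_measure = UNIV"
  by (simp add: circle_measure_def)

lemma prob_space_circle_measure: "prob_space circle_measure"
proof -
  have "prob_space (restrict_space lborel {0..<1::real})"
    by (rule prob_spaceI) (simp add: emeasure_restrict_space space_restrict_space)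
  moreover have "abs_circle \<in> restrict_space lborel {0..<1} \<rightarrow>\<^sub>M borel"
    by (rule measurable_restrict_space1) simp
  ultimately show ?thesis
    unfolding circle_measure_def by (rule prob_space.prob_space_distr)
qed

lemma prob_space_torus: "prob_space (torus d)"
  unfolding torus_def by (intro prob_space_PiM prob_space_circle_measure)

end

theory Submission
  imports Defs
begin

text \<open>
  Since \<open>2 / (1 - \<gamma>) \<ge> 2\<close>, it suffices to bound the integral by \<open>2\<close> once the norm of \<open>\<phi>\<close> is below a
  universal threshold.  Let the \<open>x\<^sub>i\<close> be independent with law \<open>\<mu> = \<rho> dx\<close>, and let \<open>K x\<close> be slightly larger
  (hence positive) than the essential supremum of \<open>\<bar>\<phi> x z\<bar>\<close> over \<open>z\<close>; the moment hypothesis says that \<open>exp (40 * K)\<close> has a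
  bounded integral.

  The diagonal terms are handled by convexity.  The off-diagonal sum is \<open>4\<close> times the mean, over
  uniformly random subsets \<open>I\<close> of the indices, of the sum over \<open>i \<in> I\<close>, \<open>j \<notin> I\<close>, so Jensen's inequality
  reduces it to a bipartite sum for a fixed \<open>I\<close>.  There, freeze \<open>Y = (x\<^sub>j)\<close>, \<open>j \<notin> I\<close>, and integrate out
  the \<open>x\<^sub>i\<close>: by the cancellation in the first variable and \<open>exp h \<le> 1 + h + h\<^sup>2 / 2 * exp \<bar>h\<bar>\<close>, what remains is at most
  \<open>exp (\<integral>x. a x * u Y x \<partial>\<mu>)\<close> with \<open>a = 32 * K\<^sup>2 * exp (8 * K)\<close>, whose integral is at most \<open>3 / 8\<close>, and
  \<open>u Y x = (\<Sum>j. \<phi> x (Y j) / K x)\<^sup>2 / N\<close>.  Jensen's inequality in \<open>x\<close> moves the exponential inside, and for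
  fixed \<open>x\<close> the summands are independent, bounded by \<open>1\<close> and centered by the cancellation in the
  second variable.  The square is therefore exponentially integrable, by Hoeffding's lemma after writing
  \<open>exp (s\<^sup>2 / 2)\<close> as the Gaussian average of \<open>exp (s * g)\<close>.
\<close>


section \<open>Gaussian integrals and exponential integrability of squared sums\<close>

lemma nn_integral_normal_density:
  assumes "\<sigma> > 0"
  shows "(\<integral>\<^sup>+ x. ennreal (normal_density \<mu> \<sigma> x) \<partial>lborel) = 1"
  using nn_integral_eq_integral[OF integrable_normal_density[OF assms, of \<mu>]]
    integral_normal_density[OF assms, of \<mu>]
  by simp

text \<open>Completing the square leaves a normal density with mean \<open>s\<close>. Read from
  right to left, the identity replaces a squared exponent by a Gaussian average of linear
  ones.\<close>

lemma nn_integral_std_normal_exp: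
  "(\<integral>\<^sup>+ x. ennreal (std_normal_density x * exp (s * x)) \<partial>lborel) = ennreal (exp (s\<^sup>2 / 2))"
proof -
  have "std_normal_density x * exp (s * x) = exp (s\<^sup>2 / 2) * normal_density s 1 x" for x
    by (simp add: normal_density_def flip: exp_add) (simp add: power2_eq_square field_simps)
  then show ?thesis
    by (simp add: ennreal_mult nn_integral_cmult nn_integral_normal_density)
qed

text \<open>The weight \<open>3 / 8\<close> lowers the Gaussian exponent from \<open>1 / 2\<close>
  to \<open>1 / 8\<close>, which is standard deviation 2; the value 2 is the ratio of the
  normalising factors. Both numbers recur below.\<close>

lemma nn_integral_std_normal_exp_square:
  "(\<integral>\<^sup>+ x. ennreal (std_normal_density x * exp (3 / 8 * x\<^sup>2)) \<partial>lborel) = 2"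
proof -
  have "sqrt 8 = 2 * sqrt 2"
    using real_sqrt_mult[of 4 2] by simp
  then have "std_normal_density x * exp (3 / 8 * x\<^sup>2) = 2 * normal_density 0 2 x" for x
    by (simp add: normal_density_def real_sqrt_mult flip: exp_add)
  then show ?thesis
    by (simp add: ennreal_mult nn_integral_cmult nn_integral_normal_density)
qed

text \<open>Hoeffding's lemma on the interval from -1 to 1 covers \<open>l > 0\<close>; negative
  \<open>l\<close> is reduced to it by changing the sign of the variable.\<close>

lemma (in prob_space) nn_integral_exp_centered_le:
  fixes \<xi> :: "'a \<Rightarrow> real"
  assumes [measurable]: "random_variable borel \<xi>"
    and bound: "AE x in M. \<bar>\<xi> x\<bar> \<le> 1" and mean: "expectation \<xi> = 0"
  shows "(\<integral>\<^sup>+ x. ennreal (exp (l * \<xi> x)) \<partial>M) \<le> ennreal (exp (l\<^sup>2 / 2))"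
proof -
  have pos: "(\<integral>\<^sup>+ x. ennreal (exp (k * f x)) \<partial>M) \<le> ennreal (exp (k\<^sup>2 / 2))"
    if [measurable]: "random_variable borel f" and "AE x in M. \<bar>f x\<bar> \<le> 1" "expectation f = 0" "k > 0"
    for f :: "'a \<Rightarrow> real" and k
  proof -
    interpret interval_bounded_random_variable M f "-1" 1
      using that by unfold_locales auto
    show ?thesis
      using Hoeffdings_lemma_nn_integral_0[OF \<open>k > 0\<close> \<open>expectation f = 0\<close>] by simp
  qed
  consider "l > 0" | "l = 0" | "l < 0" by linarith
  then show ?thesis
  proof cases
    case 1
    then show ?thesis using pos[of \<xi> l] assms by simp
  next
    case 2
    then show ?thesis by (simp add: emeasure_space_1)
  next
    case 3
    then show ?thesis using pos[of "\<lambda>x. - \<xi> x" "-l"] assms by simp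
  qed
qed

lemma (in prob_space) nn_integral_PiM_prod:
  fixes f :: "'i \<Rightarrow> 'a \<Rightarrow> ennreal"
  assumes "finite I" "\<And>i. i \<in> I \<Longrightarrow> f i \<in> borel_measurable M"
  shows "(\<integral>\<^sup>+ x. (\<Prod>i\<in>I. f i (x i)) \<partial>Pi\<^sub>M I (\<lambda>_. M)) = (\<Prod>i\<in>I. \<integral>\<^sup>+ x. f i x \<partial>M)"
proof -
  interpret product_sigma_finite "\<lambda>_::'i. M"
    by standard
  show ?thesis
    using product_nn_integral_prod[of I f] assms by simp
qed

text \<open>Once the square is linearised by a Gaussian variable \<open>g\<close>, the coordinates
  are independent and the exponential factorises. Hoeffding's lemma bounds each factor, and the
  average over \<open>g\<close> is computed exactly.\<close>

lemma (in prob_space) nn_integral_exp_square_sum_le: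
  fixes \<xi> :: "'a \<Rightarrow> real" and J :: "'i set" and N :: nat
  assumes [measurable]: "random_variable borel \<xi>"
    and bound: "AE x in M. \<bar>\<xi> x\<bar> \<le> 1" and mean: "expectation \<xi> = 0"
    and J: "finite J" "card J \<le> N" and N: "N \<ge> 1"
  shows "(\<integral>\<^sup>+ Y. ennreal (exp (3 / 8 * ((\<Sum>j\<in>J. \<xi> (Y j))\<^sup>2 / N))) \<partial>Pi\<^sub>M J (\<lambda>_. M)) \<le> 2"
proof -
  \<comment> \<open>With this scale \<open>(c * s)\<^sup>2 / 2 = 3 / 8 * (s\<^sup>2 / N)\<close>,
    and \<open>N\<close> Hoeffding factors combine to at most
    \<open>exp (3 / 8 * g\<^sup>2)\<close>.\<close>
  define c where "c = sqrt (3 / (4 * real N))"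
  have c2: "c\<^sup>2 = 3 / (4 * real N)"
    by (simp add: c_def)
  interpret P: prob_space "Pi\<^sub>M J (\<lambda>_. M)"
    by (intro prob_space_PiM prob_space_axioms)
  interpret pair_sigma_finite lborel "Pi\<^sub>M J (\<lambda>_. M)"
    by standard
  let ?S = "\<lambda>Y. \<Sum>j\<in>J. \<xi> (Y j)"
  have "(\<integral>\<^sup>+ Y. ennreal (exp (3 / 8 * ((?S Y)\<^sup>2 / N))) \<partial>Pi\<^sub>M J (\<lambda>_. M))
      = (\<integral>\<^sup>+ Y. \<integral>\<^sup>+ g. ennreal (std_normal_density g * exp (c * ?S Y * g)) \<partial>lborel \<partial>Pi\<^sub>M J (\<lambda>_. M))"
    by (subst nn_integral_std_normal_exp) (simp add: power_mult_distrib c2)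
  also have "\<dots> = (\<integral>\<^sup>+ g. \<integral>\<^sup>+ Y. ennreal (std_normal_density g * exp (c * ?S Y * g)) \<partial>Pi\<^sub>M J (\<lambda>_. M) \<partial>lborel)"
    by (rule Fubini') measurable
  also have "\<dots> \<le> (\<integral>\<^sup>+ g. ennreal (std_normal_density g * exp (3 / 8 * g\<^sup>2)) \<partial>lborel)"
  proof (rule nn_integral_mono)
    fix g :: real
    have "(\<integral>\<^sup>+ Y. ennreal (exp (c * ?S Y * g)) \<partial>Pi\<^sub>M J (\<lambda>_. M))
        = (\<integral>\<^sup>+ Y. (\<Prod>j\<in>J. ennreal (exp (c * g * \<xi> (Y j)))) \<partial>Pi\<^sub>M J (\<lambda>_. M))"
      using J(1) by (simp add: prod_ennreal sum_distrib_left sum_distrib_right mult_ac flip: exp_sum)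
    also have "\<dots> = (\<Prod>j\<in>J. \<integral>\<^sup>+ x. ennreal (exp (c * g * \<xi> x)) \<partial>M)"
      using J(1) by (intro nn_integral_PiM_prod) auto
    also have "\<dots> \<le> (\<Prod>j\<in>J. ennreal (exp ((c * g)\<^sup>2 / 2)))"
      by (intro prod_mono_ennreal nn_integral_exp_centered_le bound mean) auto
    also have "\<dots> = ennreal (exp (card J * ((c * g)\<^sup>2 / 2)))"
      by (simp only: prod_constant ennreal_power exp_ge_zero exp_of_nat_mult)
    also have "\<dots> \<le> ennreal (exp (3 / 8 * g\<^sup>2))"
    proof -
      have "card J * ((c * g)\<^sup>2 / 2) \<le> N * ((c * g)\<^sup>2 / 2)"
        using J by (intro mult_right_mono) auto
      also have "\<dots> = 3 / 8 * g\<^sup>2"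
        using N by (simp add: power_mult_distrib c2)
      finally show ?thesis by (intro ennreal_leI) simp
    qed
    finally show "(\<integral>\<^sup>+ Y. ennreal (std_normal_density g * exp (c * ?S Y * g)) \<partial>Pi\<^sub>M J (\<lambda>_. M))
        \<le> ennreal (std_normal_density g * exp (3 / 8 * g\<^sup>2))"
      by (simp add: ennreal_mult nn_integral_cmult mult_left_mono)
  qed
  also have "\<dots> = 2"
    by (rule nn_integral_std_normal_exp_square)
  finally show ?thesis .
qed

text \<open>Jensen's inequality for the probability density \<open>a / A\<close> and the function \<open>A * u\<close>.\<close>

lemma (in prob_space) exp_integral_mult_le:
  fixes a u :: "'a \<Rightarrow> real"
  assumes a: "integrable M a" "\<And>x. x \<in> space M \<Longrightarrow> 0 \<le> a x" and A: "0 < (\<integral>x. a x \<partial>M)" "(\<integral>x. a x \<partial>M) \<le> B"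
    and u[measurable]: "random_variable borel u" and au: "integrable M (\<lambda>x. a x * u x)"
    and u0: "\<And>x. x \<in> space M \<Longrightarrow> 0 \<le> u x"
  shows "ennreal (exp (\<integral>x. a x * u x \<partial>M))
    \<le> (\<integral>\<^sup>+ x. ennreal (a x / (\<integral>x. a x \<partial>M) * exp (B * u x)) \<partial>M)"
proof -
  define A where "A = (\<integral>x. a x \<partial>M)"
  define m where "m = (\<integral>x. a x * u x \<partial>M)"
  have A0: "A > 0" "A \<le> B" using A by (auto simp: A_def)
  have [measurable]: "random_variable borel a" using a(1) by auto
  \<comment> \<open>The supporting line of \<open>exp\<close> at \<open>m\<close>, evaluated at
    \<open>A * u x\<close> and weighted by \<open>a x / A\<close>. Its integral is exactly
    \<open>exp m\<close>, so Jensen's inequality follows even when the right-hand side is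
    infinite.\<close>
  let ?g = "\<lambda>x. exp m * ((1 - m) / A * a x + a x * u x)"
  have int: "integrable M ?g"
    by (intro integrable_mult_right Bochner_Integration.integrable_add a au)
  have "exp m = (\<integral>x. ?g x \<partial>M)"
  proof -
    have "(\<integral>x. ?g x \<partial>M) = exp m * ((1 - m) / A * A + m)"
      using a au by (simp add: A_def[symmetric] m_def[symmetric])
    then show ?thesis using A0 by simp
  qed
  \<comment> \<open>The supporting line may be negative while \<open>ennreal\<close> truncates at 0,
    hence the detour through the positive part.\<close>
  also have "(\<integral>x. ?g x \<partial>M) \<le> (\<integral>x. max 0 (?g x) \<partial>M)"
    by (intro integral_mono integrable_max int) auto
  finally have "ennreal (exp m) \<le> ennreal (\<integral>x. max 0 (?g x) \<partial>M)"
    by (rule ennreal_leI)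
  also have "\<dots> = (\<integral>\<^sup>+ x. ennreal (max 0 (?g x)) \<partial>M)"
    by (intro nn_integral_eq_integral[symmetric] integrable_max int) auto
  also have "\<dots> = (\<integral>\<^sup>+ x. ennreal (?g x) \<partial>M)"
    by (intro nn_integral_cong) (simp add: max_def ennreal_neg)
  also have "\<dots> \<le> (\<integral>\<^sup>+ x. ennreal (a x / A * exp (B * u x)) \<partial>M)"
  proof (intro nn_integral_mono ennreal_leI)
    fix x assume x: "x \<in> space M"
    have "?g x = a x / A * (exp m * (1 + (A * u x - m)))"
      using A0 by (simp add: field_simps)
    also have "\<dots> \<le> a x / A * (exp m * exp (A * u x - m))"
      using a(2)[OF x] A0 by (intro mult_left_mono exp_ge_add_one_self) auto
    also have "\<dots> = a x / A * exp (A * u x)"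
      by (simp flip: exp_add)
    also have "\<dots> \<le> a x / A * exp (B * u x)"
      using a(2)[OF x] A0 u0[OF x] by (intro mult_left_mono) (auto intro: mult_right_mono)
    finally show "?g x \<le> a x / A * exp (B * u x)" .
  qed
  finally show ?thesis by (simp add: A_def m_def)
qed


section \<open>Decoupling by random subsets\<close>

text \<open>Such a set arises by inserting \<open>i\<close> into an arbitrary subset of
  \<open>A - {i, j}\<close>, so a uniformly random subset separates the ordered pair with
  probability \<open>1 / 4\<close>.\<close>

lemma card_separating_subsets:
  assumes "finite A" "i \<in> A" "j \<in> A" "i \<noteq> j"
  shows "4 * card {I \<in> Pow A. i \<in> I \<and> j \<notin> I} = 2 ^ card A"
proof -
  have "bij_betw (insert i) (Pow (A - {i, j})) {I \<in> Pow A. i \<in> I \<and> j \<notin> I}"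
    by (rule bij_betw_byWitness[where f' = "\<lambda>I. I - {i}"]) (use assms in auto)
  then have "card {I \<in> Pow A. i \<in> I \<and> j \<notin> I} = 2 ^ card (A - {i, j})"
    using assms by (simp add: bij_betw_same_card[symmetric] card_Pow)
  moreover have "card A = card (A - {i, j}) + 2"
    using assms card_Diff_subset[of "{i, j}" A] card_mono[of A "{i, j}"] by auto
  ultimately show ?thesis by (simp add: power_add)
qed

text \<open>After exchanging the sums, \<open>a i j\<close> is counted once per subset that contains
  \<open>i\<close> and misses \<open>j\<close>. The factor 4 compensates for the quarter of subsets
  doing so, and diagonal terms are never counted.\<close>

lemma sum_offdiag_eq_mean_bipartite:
  fixes a :: "'i \<Rightarrow> 'i \<Rightarrow> real"
  assumes "finite A"
  shows "(\<Sum>I\<in>Pow A. 4 * (\<Sum>i\<in>I. \<Sum>j\<in>A - I. a i j))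
    = 2 ^ card A * (\<Sum>i\<in>A. \<Sum>j\<in>A - {i}. a i j)"
proof -
  have "(\<Sum>i\<in>I. \<Sum>j\<in>A - I. a i j) = (\<Sum>i\<in>A. \<Sum>j\<in>A. of_bool (i \<in> I \<and> j \<notin> I) * a i j)" if "I \<subseteq> A" for I
  proof -
    have *: "(\<Sum>j\<in>A - I. a i j) = (\<Sum>j\<in>A. of_bool (j \<notin> I) * a i j)" for i
      using assms that by (intro sum.mono_neutral_cong_left) auto
    have "(\<Sum>i\<in>I. \<Sum>j\<in>A - I. a i j) = (\<Sum>i\<in>A. of_bool (i \<in> I) * (\<Sum>j\<in>A - I. a i j))"
      using assms that by (intro sum.mono_neutral_cong_left) auto
    then show ?thesis unfolding * by (simp add: sum_distrib_left of_bool_conj mult.assoc)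
  qed
  then have "(\<Sum>I\<in>Pow A. 4 * (\<Sum>i\<in>I. \<Sum>j\<in>A - I. a i j))
      = 4 * (\<Sum>I\<in>Pow A. \<Sum>i\<in>A. \<Sum>j\<in>A. of_bool (i \<in> I \<and> j \<notin> I) * a i j)"
    by (simp add: sum_distrib_left)
  also have "\<dots> = 4 * (\<Sum>i\<in>A. \<Sum>j\<in>A. \<Sum>I\<in>Pow A. of_bool (i \<in> I \<and> j \<notin> I) * a i j)"
    by (simp only: sum.swap[of _ A "Pow A"])
  also have "\<dots> = (\<Sum>i\<in>A. \<Sum>j\<in>A. 4 * card {I \<in> Pow A. i \<in> I \<and> j \<notin> I} * a i j)"
  proof -
    have "(\<Sum>I\<in>Pow A. of_bool (i \<in> I \<and> j \<notin> I) * a i j) = card {I \<in> Pow A. i \<in> I \<and> j \<notin> I} * a i j" for i j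
      using assms by (simp del: of_bool_conj add: Int_def)
    then show ?thesis by (simp add: sum_distrib_left mult.assoc)
  qed
  also have "\<dots> = (\<Sum>i\<in>A. \<Sum>j\<in>A - {i}. 2 ^ card A * a i j)"
  proof (rule sum.cong[OF refl])
    fix i assume "i \<in> A"
    have "4 * real (card {I \<in> Pow A. i \<in> I \<and> j \<notin> I}) = 2 ^ card A" if "j \<in> A - {i}" for j
    proof -
      have "real (4 * card {I \<in> Pow A. i \<in> I \<and> j \<notin> I}) = real (2 ^ card A)"
        using that \<open>i \<in> A\<close> assms by (subst card_separating_subsets) auto
      then show ?thesis by simp
    qed
    then show "(\<Sum>j\<in>A. 4 * card {I \<in> Pow A. i \<in> I \<and> j \<notin> I} * a i j) = (\<Sum>j\<in>A - {i}. 2 ^ card A * a i j)"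
      using assms \<open>i \<in> A\<close> by (intro sum.mono_neutral_cong_right) auto
  qed
  finally show ?thesis by (simp add: sum_distrib_left)
qed

lemma exp_mean_le:
  fixes f :: "'i \<Rightarrow> real"
  assumes "finite S" "S \<noteq> {}"
  shows "exp ((\<Sum>i\<in>S. f i) / card S) \<le> (\<Sum>i\<in>S. exp (f i)) / card S"
proof -
  have "exp (\<Sum>i\<in>S. (1 / card S) *\<^sub>R f i) \<le> (\<Sum>i\<in>S. 1 / card S * exp (f i))"
    using assms convex_on_exp[of 1] by (intro convex_on_sum[where C = UNIV]) auto
  then show ?thesis by (simp add: sum_divide_distrib)
qed

text \<open>Jensen's inequality for the uniform mean over subsets. For each fixed \<open>I\<close>
  the row and column indices are disjoint, so rows and columns will involve independent
  variables.\<close>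

lemma exp_offdiag_le:
  fixes a :: "'i \<Rightarrow> 'i \<Rightarrow> real"
  assumes "finite A"
  shows "exp (t * (\<Sum>i\<in>A. \<Sum>j\<in>A - {i}. a i j))
    \<le> (\<Sum>I\<in>Pow A. exp (4 * t * (\<Sum>i\<in>I. \<Sum>j\<in>A - I. a i j))) / 2 ^ card A"
proof -
  have "t * (\<Sum>i\<in>A. \<Sum>j\<in>A - {i}. a i j)
      = t * (\<Sum>I\<in>Pow A. 4 * (\<Sum>i\<in>I. \<Sum>j\<in>A - I. a i j)) / card (Pow A)"
    using assms by (simp add: sum_offdiag_eq_mean_bipartite card_Pow)
  then have "t * (\<Sum>i\<in>A. \<Sum>j\<in>A - {i}. a i j)
      = (\<Sum>I\<in>Pow A. 4 * t * (\<Sum>i\<in>I. \<Sum>j\<in>A - I. a i j)) / card (Pow A)"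
    by (simp add: sum_distrib_left mult_ac)
  then show ?thesis
    using exp_mean_le[of "Pow A" "\<lambda>I. 4 * t * (\<Sum>i\<in>I. \<Sum>j\<in>A - I. a i j)"] assms
    by (simp add: card_Pow Pow_not_empty)
qed

section \<open>Exponential bounds from Taylor's formula and from moments\<close>

text \<open>Lagrange's form of the second-order remainder. The linear term is kept exactly because
  it will integrate to zero.\<close>

lemma exp_le_square_bound: "exp h \<le> 1 + h + h\<^sup>2 / 2 * exp \<bar>h\<bar>" for h :: real
proof -
  obtain t where t: "\<bar>t\<bar> \<le> \<bar>h\<bar>" "exp h = (\<Sum>m<2. h ^ m / fact m) + exp t / fact 2 * h ^ 2"
    using Maclaurin_exp_le[of h 2] by auto
  have "exp t * h\<^sup>2 \<le> exp \<bar>h\<bar> * h\<^sup>2"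
    using t(1) by (intro mult_right_mono) auto
  then show ?thesis
    using t(2) by (simp add: numeral_2_eq_2 field_simps)
qed

text \<open>The quotient \<open>k ^ k / fact k\<close> is a single term of the exponential series at
  \<open>k\<close>.\<close>

lemma self_power_le_fact: "real k ^ k \<le> 3 ^ k * fact k"
proof -
  have "real k ^ k / fact k \<le> exp (real k)"
    using sum_le_suminf[OF summable_exp, of "{k}" "real k"]
    by (simp add: exp_def divide_inverse mult.commute)
  also have "\<dots> = exp 1 ^ k"
    by (simp flip: exp_of_nat_mult)
  also have "\<dots> \<le> 3 ^ k"
    by (intro power_mono exp_le) auto
  finally show ?thesis by (simp add: field_simps)
qed

text \<open>In the exponential series the factorial absorbs \<open>k ^ k\<close> up to
  \<open>3 ^ k\<close>. The terms are then at most \<open>(3 * L * m) ^ k\<close>, and the smallness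
  condition makes this a geometric series of ratio at most \<open>1 / 2\<close>, with sum at most
  2.\<close>

lemma (in prob_space) nn_integral_exp_le_of_moments:
  fixes h :: "'a \<Rightarrow> real"
  assumes [measurable]: "random_variable borel h"
    and h: "\<And>x. x \<in> space M \<Longrightarrow> 0 \<le> h x"
    and mom: "\<And>k. k \<ge> 1 \<Longrightarrow> (\<integral>\<^sup>+ x. ennreal (h x ^ k) \<partial>M) \<le> ennreal ((real k * m) ^ k)"
    and m: "0 \<le> m" "0 \<le> L" "6 * L * m \<le> 1"
  shows "(\<integral>\<^sup>+ x. ennreal (exp (L * h x)) \<partial>M) \<le> 2"
proof -
  have "(\<integral>\<^sup>+ x. ennreal (exp (L * h x)) \<partial>M) = (\<integral>\<^sup>+ x. (\<Sum>k. ennreal ((L * h x) ^ k / fact k)) \<partial>M)"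
  proof (rule nn_integral_cong)
    fix x assume "x \<in> space M"
    then have "0 \<le> (L * h x) ^ k / fact k" for k
      using h[of x] m by auto
    moreover have "(\<lambda>k. (L * h x) ^ k / fact k) sums exp (L * h x)"
      using exp_converges[of "L * h x"] by (simp add: divide_inverse mult.commute)
    ultimately show "ennreal (exp (L * h x)) = (\<Sum>k. ennreal ((L * h x) ^ k / fact k))"
      by (simp only: suminf_ennreal_eq)
  qed
  also have "\<dots> = (\<Sum>k. \<integral>\<^sup>+ x. ennreal ((L * h x) ^ k / fact k) \<partial>M)"
    by (rule nn_integral_suminf) measurable
  also have "\<dots> \<le> (\<Sum>k. ennreal ((1 / 2) ^ k))"
  proof (rule suminf_le)
    fix k
    show "(\<integral>\<^sup>+ x. ennreal ((L * h x) ^ k / fact k) \<partial>M) \<le> ennreal ((1 / 2) ^ k)"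
    proof (cases "k = 0")
      case True
      then show ?thesis by (simp add: emeasure_space_1)
    next
      case False
      have "(\<integral>\<^sup>+ x. ennreal ((L * h x) ^ k / fact k) \<partial>M)
          = (\<integral>\<^sup>+ x. ennreal (L ^ k / fact k) * ennreal (h x ^ k) \<partial>M)"
        using m h by (intro nn_integral_cong) (simp add: power_mult_distrib flip: ennreal_mult)
      also have "\<dots> = ennreal (L ^ k / fact k) * (\<integral>\<^sup>+ x. ennreal (h x ^ k) \<partial>M)"
        by (rule nn_integral_cmult) measurable
      also have "\<dots> \<le> ennreal (L ^ k / fact k) * ennreal ((real k * m) ^ k)"
        using False by (intro mult_left_mono mom) auto
      also have "\<dots> = ennreal ((L * m) ^ k * (real k ^ k / fact k))"
        using m by (simp add: power_mult_distrib mult_ac flip: ennreal_mult)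
      also have "\<dots> \<le> ennreal ((1 / 2) ^ k)"
      proof (rule ennreal_leI)
        have "(L * m) ^ k * (real k ^ k / fact k) \<le> (L * m) ^ k * 3 ^ k"
          using self_power_le_fact[of k] m by (intro mult_left_mono) (auto simp: field_simps)
        also have "\<dots> = (L * m * 3) ^ k"
          by (simp add: power_mult_distrib)
        also have "\<dots> \<le> (1 / 2) ^ k"
          using m by (intro power_mono) auto
        finally show "(L * m) ^ k * (real k ^ k / fact k) \<le> (1 / 2) ^ k" .
      qed
      finally show ?thesis .
    qed
  qed (rule summableI)+
  also have "\<dots> = ennreal 2"
    by (rule suminf_ennreal_eq) (use geometric_sums[of "1 / 2 :: real"] in simp_all)
  finally show ?thesis by simp
qed


section \<open>The bipartite sum\<close>

text \<open>Since \<open>K\<close> dominates only up to null sets, the bound appears in both orders: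
  \<open>AE1\<close> serves the average over \<open>Y\<close> at fixed \<open>x\<close>,
  \<open>AE2\<close> the average over \<open>x\<close> at almost every frozen \<open>Y\<close>. The
  lower bound \<open>\<epsilon>\<close> makes division by \<open>K x\<close> harmless.\<close>

lemma (in prob_space) nn_integral_exp_bipartite_le:
  fixes \<phi> :: "'a \<Rightarrow> 'a \<Rightarrow> real" and K :: "'a \<Rightarrow> real" and I J :: "'i set" and N :: nat
  assumes \<phi>[measurable]: "(\<lambda>(x, z). \<phi> x z) \<in> borel_measurable (M \<Otimes>\<^sub>M M)"
    and B: "\<And>x z. x \<in> space M \<Longrightarrow> z \<in> space M \<Longrightarrow> \<bar>\<phi> x z\<bar> \<le> B"
    and [measurable]: "random_variable borel K"
    and K: "\<epsilon> > 0" "\<And>x. x \<in> space M \<Longrightarrow> \<epsilon> \<le> K x"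
    and AE1: "\<And>x. x \<in> space M \<Longrightarrow> AE z in M. \<bar>\<phi> x z\<bar> \<le> K x"
    and AE2: "AE z in M. AE x in M. \<bar>\<phi> x z\<bar> \<le> K x"
    and mean1: "\<And>z. z \<in> space M \<Longrightarrow> (\<integral>x. \<phi> x z \<partial>M) = 0"
    and mean2: "\<And>x. x \<in> space M \<Longrightarrow> (\<integral>z. \<phi> x z \<partial>M) = 0"
    and KM: "(\<integral>\<^sup>+ x. ennreal (32 * (K x)\<^sup>2 * exp (8 * K x)) \<partial>M) \<le> ennreal (3 / 8)"
    and IJ: "finite I" "finite J" "I \<inter> J = {}" "card I \<le> N" "card J \<le> N" "N \<ge> 1"
  shows "(\<integral>\<^sup>+ X. ennreal (exp (8 / N * (\<Sum>i\<in>I. \<Sum>j\<in>J. \<phi> (X i) (X j)))) \<partial>Pi\<^sub>M (I \<union> J) (\<lambda>_. M)) \<le> 2"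
proof -
  interpret product_sigma_finite "\<lambda>_::'i. M" by standard
  interpret PJ: prob_space "Pi\<^sub>M J (\<lambda>_. M)"
    by (intro prob_space_PiM prob_space_axioms)
  interpret F: pair_sigma_finite M "Pi\<^sub>M J (\<lambda>_. M)" by standard
  have \<phi>m[measurable (raw)]: "(\<lambda>w. \<phi> (f w) (g w)) \<in> borel_measurable L"
    if "f \<in> measurable L M" "g \<in> measurable L M" for L :: "'c measure" and f g
    using measurable_compose[OF measurable_Pair[OF that] \<phi>] by simp
  \<comment> \<open>The weight is chosen so that \<open>a x * u Y x / N\<close> equals the Taylor
    remainder \<open>(h x)\<^sup>2 / 2 * exp (8 * K x)\<close> for the exponent \<open>h\<close>
    defined below.\<close>
  define a where "a = (\<lambda>x. 32 * (K x)\<^sup>2 * exp (8 * K x))"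
  define u where "u = (\<lambda>Y x. (\<Sum>j\<in>J. \<phi> x (Y j) / K x)\<^sup>2 / N)"
  have a0: "a x > 0" if "x \<in> space M" for x
    using K(1) K(2)[OF that] by (auto simp: a_def)
  have [measurable]: "random_variable borel a" unfolding a_def by measurable
  have a_int: "integrable M a"
    using KM a0 by (intro integrableI_nonneg AE_I2) (auto simp: a_def less_imp_le intro: le_less_trans)
  define A where "A = (\<integral>x. a x \<partial>M)"
  have A_nn: "(\<integral>\<^sup>+ x. ennreal (a x) \<partial>M) = ennreal A"
    unfolding A_def using a0 by (intro nn_integral_eq_integral a_int AE_I2) (auto intro: less_imp_le)
  then have A_le: "A \<le> 3 / 8" using KM by (simp add: a_def ennreal_le_iff)
  have A0: "A > 0"
  proof -
    have "A \<noteq> 0"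
    proof
      assume "A = 0"
      then have "AE x in M. a x = 0"
        using integral_nonneg_eq_0_iff_AE[OF a_int] a0 by (auto simp: A_def less_imp_le)
      then have "AE x in M. False"
        using AE_space by eventually_elim (use a0 in force)
      then show False by simp
    qed
    moreover have "A \<ge> 0"
      unfolding A_def using a0 by (intro Bochner_Integration.integral_nonneg) (auto intro: less_imp_le)
    ultimately show ?thesis by simp
  qed
  have YJ: "Y j \<in> space M" if "Y \<in> space (Pi\<^sub>M J (\<lambda>_. M))" "j \<in> J" for Y j
    using that by (auto simp: space_PiM)
  have u0: "0 \<le> u Y x" for Y x by (simp add: u_def)
  have u_meas: "(\<lambda>x. u Y x) \<in> borel_measurable M" if "Y \<in> space (Pi\<^sub>M J (\<lambda>_. M))" for Y
  proof -
    note YJ[OF that, measurable]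
    show ?thesis unfolding u_def by measurable
  qed
  \<comment> \<open>The crude bound \<open>B / \<epsilon>\<close> on each summand serves
    integrability only and does not enter the final estimate.\<close>
  have au_int: "integrable M (\<lambda>x. a x * u Y x)" if Y: "Y \<in> space (Pi\<^sub>M J (\<lambda>_. M))" for Y
  proof (rule Bochner_Integration.integrable_bound)
    show "integrable M (\<lambda>x. a x * ((\<Sum>j\<in>J. B / \<epsilon>)\<^sup>2 / N))"
      using a_int by simp
    show "(\<lambda>x. a x * u Y x) \<in> borel_measurable M"
      using u_meas[OF Y] by measurable
    show "AE x in M. norm (a x * u Y x) \<le> norm (a x * ((\<Sum>j\<in>J. B / \<epsilon>)\<^sup>2 / N))"
    proof (rule AE_I2)
      fix x assume x: "x \<in> space M"
      have "\<bar>\<Sum>j\<in>J. \<phi> x (Y j) / K x\<bar> \<le> (\<Sum>j\<in>J. \<bar>\<phi> x (Y j) / K x\<bar>)"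
        by (rule sum_abs)
      also have "\<dots> \<le> (\<Sum>j\<in>J. B / \<epsilon>)"
      proof (rule sum_mono)
        fix j assume "j \<in> J"
        then have "\<bar>\<phi> x (Y j)\<bar> / K x \<le> B / \<epsilon>"
          using K(1) K(2)[OF x] B[OF x YJ[OF Y]] by (intro frac_le) (auto intro: order_trans[OF abs_ge_zero])
        then show "\<bar>\<phi> x (Y j) / K x\<bar> \<le> B / \<epsilon>"
          using K(1) K(2)[OF x] by (simp add: abs_divide)
      qed
      finally have "u Y x \<le> (\<Sum>j\<in>J. B / \<epsilon>)\<^sup>2 / N"
        unfolding u_def by (intro divide_right_mono) (auto intro: abs_le_square_iff[THEN iffD1] order_trans[OF _ abs_ge_self])
      then have "a x * u Y x \<le> a x * ((\<Sum>j\<in>J. B / \<epsilon>)\<^sup>2 / N)"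
        using a0[OF x] by (intro mult_left_mono) auto
      moreover have "0 \<le> a x * u Y x"
        using u0[of Y x] a0[OF x] by simp
      ultimately show "norm (a x * u Y x) \<le> norm (a x * ((\<Sum>j\<in>J. B / \<epsilon>)\<^sup>2 / N))"
        unfolding real_norm_def by linarith
    qed
  qed
  \<comment> \<open>For frozen \<open>Y\<close> the integral is a power of the one-variable integral
    of \<open>exp h\<close>. There the linear term vanishes by \<open>mean1\<close>, leaving at most
    \<open>1 + m / N\<close>, hence at most \<open>exp (m / N)\<close>; at most \<open>N\<close>
    such factors give \<open>exp m\<close>.\<close>
  have inner: "(\<integral>\<^sup>+ X. ennreal (exp (8 / N * (\<Sum>i\<in>I. \<Sum>j\<in>J. \<phi> (X i) (Y j)))) \<partial>Pi\<^sub>M I (\<lambda>_. M))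
      \<le> ennreal (exp (\<integral>x. a x * u Y x \<partial>M))"
    if Y: "Y \<in> space (Pi\<^sub>M J (\<lambda>_. M))" and bd: "\<And>j. j \<in> J \<Longrightarrow> AE x in M. \<bar>\<phi> x (Y j)\<bar> \<le> K x" for Y
  proof -
    note YJ[OF Y, measurable]
    define h where "h = (\<lambda>x. 8 / N * (\<Sum>j\<in>J. \<phi> x (Y j)))"
    have hm[measurable]: "random_variable borel h" unfolding h_def by measurable
    have h_int: "integrable M h"
      unfolding h_def using B YJ[OF Y]
      by (intro integrable_mult_right Bochner_Integration.integrable_sum integrable_const_bound[of _ B]) auto
    have h_mean: "(\<integral>x. h x \<partial>M) = 0"
    proof -
      have "integrable M (\<lambda>x. \<phi> x (Y j))" if "j \<in> J" for j
        using B YJ[OF Y that] that by (intro integrable_const_bound[of _ B]) auto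
      then show ?thesis unfolding h_def by (simp add: mean1 YJ[OF Y])
    qed
    have h_bd: "\<bar>h x\<bar> \<le> 8 / N * (\<Sum>j\<in>J. c)" if "\<And>j. j \<in> J \<Longrightarrow> \<bar>\<phi> x (Y j)\<bar> \<le> c" for x c
    proof -
      have "\<bar>\<Sum>j\<in>J. \<phi> x (Y j)\<bar> \<le> (\<Sum>j\<in>J. c)"
        using that by (intro order_trans[OF sum_abs] sum_mono) auto
      then show ?thesis unfolding h_def abs_mult by (intro mult_mono) auto
    qed
    have exp_int: "integrable M (\<lambda>x. exp (h x))"
    proof (rule integrable_const_bound)
      show "AE x in M. norm (exp (h x)) \<le> exp (8 / N * (\<Sum>j\<in>J. B))"
        using h_bd[of _ B] B YJ[OF Y] by (intro AE_I2) (auto intro: order_trans[OF abs_ge_self])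
    qed measurable
    define m where "m = (\<integral>x. a x * u Y x \<partial>M)"
    have m0: "m \<ge> 0"
      unfolding m_def using a0 u0
      by (intro Bochner_Integration.integral_nonneg mult_nonneg_nonneg) (auto intro: less_imp_le)
    have "(\<integral>x. exp (h x) \<partial>M) \<le> (\<integral>x. 1 + h x + a x * u Y x / N \<partial>M)"
    proof (rule integral_mono_AE[OF exp_int])
      show "integrable M (\<lambda>x. 1 + h x + a x * u Y x / N)"
        using h_int au_int[OF Y] by auto
      have "AE x in M. \<forall>j\<in>J. \<bar>\<phi> x (Y j)\<bar> \<le> K x"
        using bd IJ(2) by (simp add: AE_finite_all)
      then show "AE x in M. exp (h x) \<le> 1 + h x + a x * u Y x / N"
        using AE_space
      proof eventually_elim
        case (elim x)
        have Kx: "K x > 0" using K(1) K(2)[OF elim(2)] by simp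
        have "\<bar>h x\<bar> \<le> 8 / N * (\<Sum>j\<in>J. K x)"
          using elim by (intro h_bd) auto
        also have "\<dots> = 8 * (card J / N) * K x" by simp
        also have "\<dots> \<le> 8 * 1 * K x"
          using IJ Kx by (intro mult_mono) auto
        finally have "exp \<bar>h x\<bar> \<le> exp (8 * K x)" by simp
        then have "(h x)\<^sup>2 / 2 * exp \<bar>h x\<bar> \<le> (h x)\<^sup>2 / 2 * exp (8 * K x)"
          by (intro mult_left_mono) auto
        also have "\<dots> = a x * u Y x / N"
          using Kx IJ(6) unfolding a_def u_def h_def
          by (simp add: sum_divide_distrib[symmetric] power_mult_distrib power_divide field_simps)
            (simp add: power2_eq_square)
        finally show ?case using exp_le_square_bound[of "h x"] by linarith
      qed
    qed
    also have "\<dots> = 1 + m / N"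
      using h_int au_int[OF Y] by (simp add: h_mean m_def prob_space)
    also have "\<dots> \<le> exp (m / N)"
      by (rule exp_ge_add_one_self)
    finally have *: "(\<integral>\<^sup>+ x. ennreal (exp (h x)) \<partial>M) \<le> ennreal (exp (m / N))"
      by (subst nn_integral_eq_integral[OF exp_int]) (auto intro: ennreal_leI)
    have "(\<integral>\<^sup>+ X. ennreal (exp (8 / N * (\<Sum>i\<in>I. \<Sum>j\<in>J. \<phi> (X i) (Y j)))) \<partial>Pi\<^sub>M I (\<lambda>_. M))
        = (\<integral>\<^sup>+ X. (\<Prod>i\<in>I. ennreal (exp (h (X i)))) \<partial>Pi\<^sub>M I (\<lambda>_. M))"
      using IJ(1) by (simp add: prod_ennreal sum_distrib_left h_def flip: exp_sum)
    also have "\<dots> = (\<Prod>i\<in>I. \<integral>\<^sup>+ x. ennreal (exp (h x)) \<partial>M)"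
      by (intro nn_integral_PiM_prod IJ(1)) measurable
    also have "\<dots> \<le> (\<Prod>i\<in>I. ennreal (exp (m / N)))"
      by (intro prod_mono_ennreal *)
    also have "\<dots> = ennreal (exp (card I * (m / N)))"
      by (simp only: prod_constant ennreal_power exp_ge_zero exp_of_nat_mult)
    also have "\<dots> \<le> ennreal (exp m)"
    proof -
      have "card I * (m / N) \<le> N * (m / N)"
        using IJ m0 by (intro mult_right_mono) auto
      then show ?thesis using IJ(6) by (intro ennreal_leI) simp
    qed
    finally show ?thesis by (simp add: m_def)
  qed
  \<comment> \<open>The number \<open>3 / 8\<close> bounds the mass \<open>A\<close> and is also the
    exponent at which the squared sum has exponential integral at most 2. The normalisation
    \<open>1 / A\<close> then cancels the mass of \<open>a\<close>.\<close>
  have swap: "(\<integral>\<^sup>+ Y. ennreal (exp (\<integral>x. a x * u Y x \<partial>M)) \<partial>Pi\<^sub>M J (\<lambda>_. M)) \<le> 2"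
  proof -
    have "(\<integral>\<^sup>+ Y. ennreal (exp (\<integral>x. a x * u Y x \<partial>M)) \<partial>Pi\<^sub>M J (\<lambda>_. M))
        \<le> (\<integral>\<^sup>+ Y. \<integral>\<^sup>+ x. ennreal (a x / A * exp (3 / 8 * u Y x)) \<partial>M \<partial>Pi\<^sub>M J (\<lambda>_. M))"
      unfolding A_def using a_int a0 A0 A_le u0 u_meas au_int
      by (intro nn_integral_mono exp_integral_mult_le) (auto simp: A_def less_imp_le)
    also have "\<dots> = (\<integral>\<^sup>+ x. \<integral>\<^sup>+ Y. ennreal (a x / A * exp (3 / 8 * u Y x)) \<partial>Pi\<^sub>M J (\<lambda>_. M) \<partial>M)"
      unfolding u_def by (rule F.Fubini') measurable
    also have "\<dots> \<le> (\<integral>\<^sup>+ x. ennreal (a x) * ennreal (2 / A) \<partial>M)"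
    proof (rule nn_integral_mono)
      fix x assume x[measurable]: "x \<in> space M"
      have Kx: "K x > 0" using K(1) K(2)[OF x] by simp
      have um: "(\<lambda>Y. u Y x) \<in> borel_measurable (Pi\<^sub>M J (\<lambda>_. M))"
        unfolding u_def by measurable
      have "(\<integral>\<^sup>+ Y. ennreal (exp (3 / 8 * u Y x)) \<partial>Pi\<^sub>M J (\<lambda>_. M)) \<le> 2"
        unfolding u_def
      proof (rule nn_integral_exp_square_sum_le[OF _ _ _ IJ(2,5,6)])
        show "AE z in M. \<bar>\<phi> x z / K x\<bar> \<le> 1"
          using AE1[OF x] by eventually_elim (use Kx in simp)
        show "(\<integral>z. \<phi> x z / K x \<partial>M) = 0"
          using mean2[OF x] by simp
      qed measurable
      then have "ennreal (a x / A) * (\<integral>\<^sup>+ Y. ennreal (exp (3 / 8 * u Y x)) \<partial>Pi\<^sub>M J (\<lambda>_. M)) \<le> ennreal (a x / A) * 2"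
        by (rule mult_left_mono) simp
      also have "ennreal (a x / A) * 2 = ennreal (a x) * ennreal (2 / A)"
        using a0[OF x] A0 by (simp flip: ennreal_mult ennreal_numeral)
      finally show "(\<integral>\<^sup>+ Y. ennreal (a x / A * exp (3 / 8 * u Y x)) \<partial>Pi\<^sub>M J (\<lambda>_. M)) \<le> ennreal (a x) * ennreal (2 / A)"
        using a0[OF x] A0 um
        by (simp add: ennreal_mult nn_integral_cmult del: times_divide_eq_left times_divide_eq_right)
    qed
    also have "\<dots> = ennreal A * ennreal (2 / A)"
      by (simp add: nn_integral_multc A_nn)
    also have "\<dots> = 2"
      using A0 by (simp flip: ennreal_mult)
    finally show ?thesis .
  qed
  \<comment> \<open>The union is commuted so that the block \<open>J\<close> becomes the outer
    integral and is frozen while \<open>I\<close> is integrated.\<close>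
  have "(\<integral>\<^sup>+ X. ennreal (exp (8 / N * (\<Sum>i\<in>I. \<Sum>j\<in>J. \<phi> (X i) (X j)))) \<partial>Pi\<^sub>M (I \<union> J) (\<lambda>_. M))
      = (\<integral>\<^sup>+ Y. \<integral>\<^sup>+ X. ennreal (exp (8 / N * (\<Sum>i\<in>I. \<Sum>j\<in>J. \<phi> (merge J I (Y, X) i) (merge J I (Y, X) j))))
          \<partial>Pi\<^sub>M I (\<lambda>_. M) \<partial>Pi\<^sub>M J (\<lambda>_. M))"
    using IJ by (subst Un_commute, subst product_nn_integral_fold) (auto simp: Int_commute)
  also have "\<dots> = (\<integral>\<^sup>+ Y. \<integral>\<^sup>+ X. ennreal (exp (8 / N * (\<Sum>i\<in>I. \<Sum>j\<in>J. \<phi> (X i) (Y j))))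
          \<partial>Pi\<^sub>M I (\<lambda>_. M) \<partial>Pi\<^sub>M J (\<lambda>_. M))"
  proof -
    have "(\<Sum>i\<in>I. \<Sum>j\<in>J. \<phi> (merge J I (Y, X) i) (merge J I (Y, X) j)) = (\<Sum>i\<in>I. \<Sum>j\<in>J. \<phi> (X i) (Y j))" for X Y
      using IJ(3) by (intro sum.cong refl) (auto simp: merge_def)
    then show ?thesis by simp
  qed
  also have "\<dots> \<le> (\<integral>\<^sup>+ Y. ennreal (exp (\<integral>x. a x * u Y x \<partial>M)) \<partial>Pi\<^sub>M J (\<lambda>_. M))"
  proof (rule nn_integral_mono_AE)
    have "AE Y in Pi\<^sub>M J (\<lambda>_. M). \<forall>j\<in>J. AE x in M. \<bar>\<phi> x (Y j)\<bar> \<le> K x"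
      unfolding AE_finite_all[OF IJ(2)]
      using AE_PiM_component[of J "\<lambda>_. M" _ "\<lambda>z. AE x in M. \<bar>\<phi> x z\<bar> \<le> K x"] AE2 prob_space_axioms by blast
    then show "AE Y in Pi\<^sub>M J (\<lambda>_. M).
        (\<integral>\<^sup>+ X. ennreal (exp (8 / N * (\<Sum>i\<in>I. \<Sum>j\<in>J. \<phi> (X i) (Y j)))) \<partial>Pi\<^sub>M I (\<lambda>_. M))
        \<le> ennreal (exp (\<integral>x. a x * u Y x \<partial>M))"
      using AE_space by eventually_elim (use inner in blast)
  qed
  also note swap
  finally show ?thesis .
qed


section \<open>Diagonal terms and the full double sum\<close>

lemma (in prob_space) nn_integral_PiM_component:
  assumes "i \<in> I" and [measurable]: "f \<in> borel_measurable M"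
  shows "(\<integral>\<^sup>+ X. f (X i) \<partial>Pi\<^sub>M I (\<lambda>_. M)) = (\<integral>\<^sup>+ x. f x \<partial>M)"
proof -
  have "(\<integral>\<^sup>+ x. f x \<partial>M) = (\<integral>\<^sup>+ x. f x \<partial>distr (Pi\<^sub>M I (\<lambda>_. M)) M (\<lambda>X. X i))"
    using distr_PiM_component[of I "\<lambda>_. M" i] assms(1) prob_space_axioms by simp
  also have "\<dots> = (\<integral>\<^sup>+ X. f (X i) \<partial>Pi\<^sub>M I (\<lambda>_. M))"
    using assms(1) by (subst nn_integral_distr) auto
  finally show ?thesis by simp
qed

text \<open>Convexity bounds the exponential of the mean by the mean of \<open>N\<close>
  exponentials, all with the same integral because each coordinate has law \<open>M\<close>.\<close>

lemma (in prob_space) nn_integral_exp_diag_le: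
  fixes D :: "'a \<Rightarrow> real" and N :: nat
  assumes [measurable]: "random_variable borel D" and N: "N \<ge> 1"
  shows "(\<integral>\<^sup>+ X. ennreal (exp ((\<Sum>i<N. D (X i)) / N)) \<partial>Pi\<^sub>M {..<N} (\<lambda>_. M)) \<le> (\<integral>\<^sup>+ x. ennreal (exp (D x)) \<partial>M)"
proof -
  have ne: "{..<N} \<noteq> {}" using N by (auto simp: lessThan_empty_iff)
  have "(\<integral>\<^sup>+ X. ennreal (exp ((\<Sum>i<N. D (X i)) / N)) \<partial>Pi\<^sub>M {..<N} (\<lambda>_. M))
      \<le> (\<integral>\<^sup>+ X. ennreal (1 / N) * (\<Sum>i<N. ennreal (exp (D (X i)))) \<partial>Pi\<^sub>M {..<N} (\<lambda>_. M))"
  proof (rule nn_integral_mono)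
    fix X :: "nat \<Rightarrow> 'a"
    have "exp ((\<Sum>i<N. D (X i)) / N) \<le> 1 / N * (\<Sum>i<N. exp (D (X i)))"
      using exp_mean_le[OF finite_lessThan ne, of "\<lambda>i. D (X i)"] by simp
    then have "ennreal (exp ((\<Sum>i<N. D (X i)) / N)) \<le> ennreal (1 / N * (\<Sum>i<N. exp (D (X i))))"
      by (rule ennreal_leI)
    then show "ennreal (exp ((\<Sum>i<N. D (X i)) / N)) \<le> ennreal (1 / N) * (\<Sum>i<N. ennreal (exp (D (X i))))"
      by (simp only: sum_ennreal exp_ge_zero ennreal_mult divide_nonneg_nonneg zero_le_one of_nat_0_le_iff sum_nonneg)
  qed
  also have "\<dots> = ennreal (1 / N) * (\<Sum>i<N. \<integral>\<^sup>+ X. ennreal (exp (D (X i))) \<partial>Pi\<^sub>M {..<N} (\<lambda>_. M))"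
    by (subst nn_integral_cmult) (measurable, subst nn_integral_sum, auto)
  also have "\<dots> = ennreal (1 / N) * (\<Sum>i<N. \<integral>\<^sup>+ x. ennreal (exp (D x)) \<partial>M)"
    by (intro arg_cong2[where f = "(*)"] sum.cong refl
        nn_integral_PiM_component[where f = "\<lambda>x. ennreal (exp (D x))"]) auto
  also have "\<dots> = (\<integral>\<^sup>+ x. ennreal (exp (D x)) \<partial>M)"
    using N by (simp add: mult.assoc[symmetric] ennreal_of_nat_eq_real_of_nat flip: ennreal_mult)
  finally show ?thesis .
qed

lemma (in prob_space) nn_integral_exp_pair_interaction_le:
  fixes \<phi> :: "'a \<Rightarrow> 'a \<Rightarrow> real" and K :: "'a \<Rightarrow> real" and N :: nat
  assumes \<phi>[measurable]: "(\<lambda>(x, z). \<phi> x z) \<in> borel_measurable (M \<Otimes>\<^sub>M M)"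
    and B: "\<And>x z. x \<in> space M \<Longrightarrow> z \<in> space M \<Longrightarrow> \<bar>\<phi> x z\<bar> \<le> B"
    and [measurable]: "random_variable borel K"
    and K: "\<epsilon> > 0" "\<And>x. x \<in> space M \<Longrightarrow> \<epsilon> \<le> K x"
    and AE1: "\<And>x. x \<in> space M \<Longrightarrow> AE z in M. \<bar>\<phi> x z\<bar> \<le> K x"
    and mean1: "\<And>z. z \<in> space M \<Longrightarrow> (\<integral>x. \<phi> x z \<partial>M) = 0"
    and mean2: "\<And>x. x \<in> space M \<Longrightarrow> (\<integral>z. \<phi> x z \<partial>M) = 0"
    and KM: "(\<integral>\<^sup>+ x. ennreal (32 * (K x)\<^sup>2 * exp (8 * K x)) \<partial>M) \<le> ennreal (3 / 8)"
    and diag: "(\<integral>\<^sup>+ x. ennreal (exp (2 * \<phi> x x)) \<partial>M) \<le> 2"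
    and N: "N \<ge> 1"
  shows "(\<integral>\<^sup>+ X. ennreal (exp (1 / N * (\<Sum>i<N. \<Sum>j<N. \<phi> (X i) (X j)))) \<partial>Pi\<^sub>M {..<N} (\<lambda>_. M)) \<le> 2"
proof -
  interpret F: pair_sigma_finite M M by standard
  let ?P = "Pi\<^sub>M {..<N} (\<lambda>_. M)"
  have \<phi>m[measurable (raw)]: "(\<lambda>w. \<phi> (f w) (g w)) \<in> borel_measurable L"
    if "f \<in> measurable L M" "g \<in> measurable L M" for L :: "'c measure" and f g
    using measurable_compose[OF measurable_Pair[OF that] \<phi>] by simp
  \<comment> \<open>Fubini's theorem for null sets; the exceptional set is measurable because
    \<open>K\<close> is.\<close>
  have AE2: "AE z in M. AE x in M. \<bar>\<phi> x z\<bar> \<le> K x"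
  proof (rule F.AE_commute[of "\<lambda>x z. \<bar>\<phi> x z\<bar> \<le> K x", THEN iffD1])
    show "{p \<in> space (M \<Otimes>\<^sub>M M). \<bar>\<phi> (fst p) (snd p)\<bar> \<le> K (fst p)} \<in> sets (M \<Otimes>\<^sub>M M)"
      by measurable
    show "AE x in M. AE z in M. \<bar>\<phi> x z\<bar> \<le> K x"
      using AE1 by (rule AE_I2)
  qed
  \<comment> \<open>Both parts carry a factor 2 because they are separated by
    \<open>exp ((p + q) / 2) \<le> (exp p + exp q) / 2\<close>. With the factor 4 from the random
    subsets, this produces the \<open>8 / N\<close> of the bipartite estimate.\<close>
  define diagf where "diagf = (\<lambda>X. (\<Sum>i<N. 2 * \<phi> (X i) (X i)) / real N)"
  define off where "off = (\<lambda>X. 2 / real N * (\<Sum>i<N. \<Sum>j\<in>{..<N} - {i}. \<phi> (X i) (X j)))"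
  have [measurable]: "diagf \<in> borel_measurable ?P" "off \<in> borel_measurable ?P"
    unfolding diagf_def off_def by measurable
  have "(\<integral>\<^sup>+ X. ennreal (exp (1 / N * (\<Sum>i<N. \<Sum>j<N. \<phi> (X i) (X j)))) \<partial>?P)
      \<le> (\<integral>\<^sup>+ X. ennreal (1 / 2) * (ennreal (exp (diagf X)) + ennreal (exp (off X))) \<partial>?P)"
  proof (rule nn_integral_mono)
    fix X :: "nat \<Rightarrow> 'a"
    have "(\<Sum>i<N. \<Sum>j<N. \<phi> (X i) (X j)) = (\<Sum>i<N. \<phi> (X i) (X i) + (\<Sum>j\<in>{..<N} - {i}. \<phi> (X i) (X j)))"
      by (intro sum.cong refl sum.remove) auto
    then have eq: "1 / N * (\<Sum>i<N. \<Sum>j<N. \<phi> (X i) (X j)) = (diagf X + off X) / 2"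
      by (simp add: diagf_def off_def sum.distrib sum_distrib_left[symmetric] add_divide_distrib)
    have "0 \<le> (exp (diagf X / 2) - exp (off X / 2))\<^sup>2" by simp
    then have "exp ((diagf X + off X) / 2) \<le> 1 / 2 * (exp (diagf X) + exp (off X))"
      by (simp add: power2_eq_square algebra_simps add_divide_distrib flip: exp_add)
    then show "ennreal (exp (1 / N * (\<Sum>i<N. \<Sum>j<N. \<phi> (X i) (X j))))
        \<le> ennreal (1 / 2) * (ennreal (exp (diagf X)) + ennreal (exp (off X)))"
      unfolding eq by (subst ennreal_plus[symmetric], simp, simp, subst ennreal_mult[symmetric])
        (auto intro: ennreal_leI simp del: times_divide_eq_left)
  qed
  also have "\<dots> = ennreal (1 / 2) * ((\<integral>\<^sup>+ X. ennreal (exp (diagf X)) \<partial>?P) + (\<integral>\<^sup>+ X. ennreal (exp (off X)) \<partial>?P))"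
    by (simp add: nn_integral_cmult nn_integral_add)
  also have "\<dots> \<le> ennreal (1 / 2) * (2 + 2)"
  proof (intro mult_left_mono add_mono)
    show "(\<integral>\<^sup>+ X. ennreal (exp (diagf X)) \<partial>?P) \<le> 2"
      unfolding diagf_def
      using nn_integral_exp_diag_le[of "\<lambda>x. 2 * \<phi> x x" N] diag N by auto
    have "(\<integral>\<^sup>+ X. ennreal (exp (off X)) \<partial>?P)
        \<le> (\<integral>\<^sup>+ X. ennreal (1 / 2 ^ N) * (\<Sum>I\<in>Pow {..<N}.
            ennreal (exp (8 / N * (\<Sum>i\<in>I. \<Sum>j\<in>{..<N} - I. \<phi> (X i) (X j))))) \<partial>?P)"
    proof (rule nn_integral_mono)
      fix X :: "nat \<Rightarrow> 'a"
      have "exp (off X) \<le> 1 / 2 ^ N * (\<Sum>I\<in>Pow {..<N}. exp (8 / N * (\<Sum>i\<in>I. \<Sum>j\<in>{..<N} - I. \<phi> (X i) (X j))))"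
        using exp_offdiag_le[of "{..<N}" "2 / N" "\<lambda>i j. \<phi> (X i) (X j)"] by (simp add: off_def)
      then have "ennreal (exp (off X))
          \<le> ennreal (1 / 2 ^ N * (\<Sum>I\<in>Pow {..<N}. exp (8 / N * (\<Sum>i\<in>I. \<Sum>j\<in>{..<N} - I. \<phi> (X i) (X j)))))"
        by (rule ennreal_leI)
      then show "ennreal (exp (off X)) \<le> ennreal (1 / 2 ^ N) * (\<Sum>I\<in>Pow {..<N}.
            ennreal (exp (8 / N * (\<Sum>i\<in>I. \<Sum>j\<in>{..<N} - I. \<phi> (X i) (X j)))))"
        by (subst sum_ennreal) (simp_all add: sum_nonneg flip: ennreal_mult)
    qed
    also have "\<dots> = ennreal (1 / 2 ^ N) * (\<Sum>I\<in>Pow {..<N}. \<integral>\<^sup>+ X.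
            ennreal (exp (8 / N * (\<Sum>i\<in>I. \<Sum>j\<in>{..<N} - I. \<phi> (X i) (X j)))) \<partial>?P)"
    proof -
      have meas: "(\<lambda>X. ennreal (exp (8 / N * (\<Sum>i\<in>I. \<Sum>j\<in>{..<N} - I. \<phi> (X i) (X j))))) \<in> borel_measurable ?P"
        if "I \<in> Pow {..<N}" for I
      proof -
        have [measurable]: "(\<lambda>X. X i) \<in> measurable ?P M" if "i \<in> I" for i
          using that \<open>I \<in> Pow {..<N}\<close> by (intro measurable_component_singleton) auto
        show ?thesis by measurable
      qed
      show ?thesis
        by (subst nn_integral_cmult[OF borel_measurable_sum[OF meas]], assumption)
          (simp only: nn_integral_sum[OF meas])
    qed
    also have "\<dots> \<le> ennreal (1 / 2 ^ N) * (\<Sum>I\<in>Pow {..<N}. 2)"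
    proof (intro mult_left_mono sum_mono)
      fix I assume "I \<in> Pow {..<N}"
      then have I: "I \<subseteq> {..<N}" "finite I" by (auto intro: finite_subset)
      then have "card I \<le> N" "card ({..<N} - I) \<le> N"
        using card_mono[of "{..<N}" I] card_mono[of "{..<N}" "{..<N} - I"] by auto
      moreover have "I \<union> ({..<N} - I) = {..<N}" using I by auto
      ultimately show "(\<integral>\<^sup>+ X. ennreal (exp (8 / N * (\<Sum>i\<in>I. \<Sum>j\<in>{..<N} - I. \<phi> (X i) (X j)))) \<partial>?P) \<le> 2"
        using nn_integral_exp_bipartite_le[OF \<phi> B _ K AE1 AE2 mean1 mean2 KM, of I "{..<N} - I" N] I N
        by simp
    qed auto
    also have "\<dots> = 2"
    proof -
      have "(\<Sum>I\<in>Pow {..<N}. 2) = ennreal (2 ^ N * 2)"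
        by (simp add: card_Pow ennreal_mult ennreal_power[symmetric])
      then show ?thesis by (simp flip: ennreal_mult)
    qed
    finally show "(\<integral>\<^sup>+ X. ennreal (exp (off X)) \<partial>?P) \<le> 2" .
  qed auto
  also have "\<dots> = 2"
  proof -
    have "(2 + 2 :: ennreal) = ennreal 4" by simp
    then show ?thesis by (simp only:) (subst ennreal_mult[symmetric], auto)
  qed
  finally show ?thesis .
qed


section \<open>The essential supremum and moments from the norm hypothesis\<close>

text \<open>The pointwise supremum over \<open>z\<close> need not be Borel measurable; the essential supremum, written as a
  supremum over rational levels, is.\<close>

lemma (in prob_space) measurable_ess_sup_section:
  fixes \<phi> :: "'a \<Rightarrow> 'a \<Rightarrow> real"
  assumes \<phi>[measurable]: "(\<lambda>(x, z). \<phi> x z) \<in> borel_measurable (M \<Otimes>\<^sub>M M)"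
    and B: "\<And>x z. x \<in> space M \<Longrightarrow> z \<in> space M \<Longrightarrow> \<bar>\<phi> x z\<bar> \<le> B"
  obtains G where "random_variable borel G"
    "\<And>x. x \<in> space M \<Longrightarrow> 0 \<le> G x"
    "\<And>x. x \<in> space M \<Longrightarrow> G x \<le> (SUP z\<in>space M. \<bar>\<phi> x z\<bar>)"
    "\<And>x. x \<in> space M \<Longrightarrow> AE z in M. \<bar>\<phi> x z\<bar> \<le> G x"
proof
  define Q :: "real set" where "Q = {q \<in> \<rat>. 0 \<le> q}"
  define level where "level = (\<lambda>q x. emeasure M {z \<in> space M. q < \<bar>\<phi> x z\<bar>})"
  \<comment> \<open>A level counts while \<open>\<bar>\<phi> x z\<bar>\<close> exceeds it with
    positive probability, and is replaced by the neutral value 0 otherwise.\<close>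
  define F where "F = (\<lambda>q x. if level q x = 0 then 0 else q)"
  define G where "G = (\<lambda>x. SUP q\<in>Q. F q x)"
  have Q: "countable Q" "0 \<in> Q"
    unfolding Q_def by (auto intro: countable_subset[OF _ countable_rat])
  have \<phi>m[measurable (raw)]: "(\<lambda>w. \<phi> (f w) (g w)) \<in> borel_measurable L"
    if "f \<in> measurable L M" "g \<in> measurable L M" for L :: "'c measure" and f g
    using measurable_compose[OF measurable_Pair[OF that] \<phi>] by simp
  have [measurable]: "level q \<in> borel_measurable M" for q
    unfolding level_def by measurable
  have [measurable]: "F q \<in> borel_measurable M" for q
    unfolding F_def by measurable
  have F_le: "F q x \<le> (SUP z\<in>space M. \<bar>\<phi> x z\<bar>)" if x: "x \<in> space M" for q x
  proof -
    have bdd: "bdd_above ((\<lambda>z. \<bar>\<phi> x z\<bar>) ` space M)"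
      using B[OF x] by (auto intro!: bdd_aboveI)
    show ?thesis
    proof (cases "level q x = 0")
      case True
      obtain z where z: "z \<in> space M" using not_empty by auto
      have "0 \<le> \<bar>\<phi> x z\<bar>" by simp
      also have "\<dots> \<le> (SUP z\<in>space M. \<bar>\<phi> x z\<bar>)"
        by (rule cSUP_upper[OF z bdd])
      finally show ?thesis using True by (simp add: F_def)
    next
      \<comment> \<open>A set of positive measure is nonempty, so the level lies below an attained
        value and hence below the pointwise supremum.\<close>
      case False
      then have "{z \<in> space M. q < \<bar>\<phi> x z\<bar>} \<noteq> {}"
        unfolding level_def by (metis emeasure_empty)
      then obtain z where z: "z \<in> space M" "q < \<bar>\<phi> x z\<bar>" by auto
      then show ?thesis
        using False cSUP_upper[OF z(1) bdd] by (simp add: F_def)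
    qed
  qed
  have F_bdd: "bdd_above ((\<lambda>q. F q x) ` Q)" if "x \<in> space M" for x
    using F_le[OF that] by (auto intro!: bdd_aboveI)
  show "random_variable borel G"
    unfolding G_def using Q(1) F_bdd by (intro borel_measurable_cSUP) auto
  show "0 \<le> G x" if "x \<in> space M" for x
    using cSUP_upper[OF Q(2) F_bdd[OF that]] by (simp add: G_def F_def)
  show "G x \<le> (SUP z\<in>space M. \<bar>\<phi> x z\<bar>)" if "x \<in> space M" for x
    unfolding G_def using Q(2) F_le[OF that] by (intro cSUP_least) auto
  show "AE z in M. \<bar>\<phi> x z\<bar> \<le> G x" if x[measurable]: "x \<in> space M" for x
  proof -
    \<comment> \<open>Only countably many null sets are discarded; a value above \<open>G x\<close>
      would leave room for a rational level in between.\<close>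
    have "AE z in M. \<forall>q\<in>Q. G x < q \<longrightarrow> \<bar>\<phi> x z\<bar> \<le> q"
      unfolding AE_ball_countable[OF Q(1)]
    proof
      fix q assume q: "q \<in> Q"
      show "AE z in M. G x < q \<longrightarrow> \<bar>\<phi> x z\<bar> \<le> q"
      proof (cases "G x < q")
        case True
        then have "F q x \<noteq> q"
          using cSUP_upper[OF q F_bdd[OF x]] by (auto simp: G_def)
        then have "level q x = 0" by (auto simp: F_def split: if_splits)
        then have "AE z in M. \<not> q < \<bar>\<phi> x z\<bar>"
          by (intro AE_iff_measurable[THEN iffD2]) (auto simp: level_def)
        then show ?thesis by eventually_elim auto
      qed simp
    qed
    then show ?thesis
    proof eventually_elim
      case (elim z)
      show ?case
      proof (rule ccontr)
        assume "\<not> \<bar>\<phi> x z\<bar> \<le> G x"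
        then obtain q where "q \<in> \<rat>" "G x < q" "q < \<bar>\<phi> x z\<bar>"
          using Rats_dense_in_real[of "G x" "\<bar>\<phi> x z\<bar>"] by auto
        moreover have "q \<in> Q"
          using calculation \<open>x \<in> space M \<Longrightarrow> 0 \<le> G x\<close>[OF x] by (auto simp: Q_def)
        ultimately show False using elim by force
      qed
    qed
  qed
qed

text \<open>The supremum \<open>S\<close> gives \<open>Lp_norm M p f \<le> p * S\<close>, and the
  case \<open>p = k\<close> is a moment bound. It passes from the possibly non-measurable
  \<open>f\<close> to \<open>h\<close> by monotonicity of the nonnegative integral.\<close>

lemma (in prob_space) nn_integral_power_le_of_SUP_Lp_norm:
  fixes f h :: "'a \<Rightarrow> real"
  assumes f: "\<And>x. x \<in> space M \<Longrightarrow> f x \<le> B"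
    and h: "\<And>x. x \<in> space M \<Longrightarrow> 0 \<le> h x" "\<And>x. x \<in> space M \<Longrightarrow> h x \<le> f x"
  defines "S \<equiv> (SUP p\<in>{1..}. Lp_norm M p f / p)"
  shows "0 \<le> S"
    and "k \<ge> 1 \<Longrightarrow> (\<integral>\<^sup>+ x. ennreal (h x ^ k) \<partial>M) \<le> ennreal ((real k * S) ^ k)"
proof -
  define T where "T = (\<lambda>p. \<integral>\<^sup>+ x. ennreal (\<bar>f x\<bar> powr p) \<partial>M)"
  have f0: "0 \<le> f x" if "x \<in> space M" for x
    using h[OF that] by simp
  obtain x0 where "x0 \<in> space M" using not_empty by auto
  then have B0: "0 \<le> B" using f f0 by force
  \<comment> \<open>Finiteness matters: \<open>enn2real\<close> would turn an infinite integral into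
    0, and the norm would no longer control the moment.\<close>
  have T_le: "T p \<le> ennreal (B powr p)" if "p \<ge> 1" for p
  proof -
    have "T p \<le> (\<integral>\<^sup>+ x. ennreal (B powr p) \<partial>M)"
      unfolding T_def using f f0 that by (intro nn_integral_mono ennreal_leI powr_mono2) auto
    then show ?thesis by (simp add: emeasure_space_1)
  qed
  have norm_le: "Lp_norm M p f \<le> B" if "p \<ge> 1" for p
  proof -
    have "enn2real (T p) \<le> B powr p"
      using T_le[OF that] by (simp add: enn2real_leI)
    then have "enn2real (T p) powr (1 / p) \<le> (B powr p) powr (1 / p)"
      using that by (intro powr_mono2) auto
    then show ?thesis
      using that B0 by (simp add: Lp_norm_def T_def powr_powr)
  qed
  \<comment> \<open>A real supremum is an upper bound only for a set that is bounded above.\<close>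
  have bdd: "bdd_above ((\<lambda>p. Lp_norm M p f / p) ` {1..})"
  proof (rule bdd_aboveI2)
    fix p :: real assume "p \<in> {1..}"
    then have p: "p \<ge> 1" by simp
    then have "Lp_norm M p f / p \<le> B / 1"
      using norm_le[OF p] B0 by (intro frac_le) auto
    then show "Lp_norm M p f / p \<le> B" by simp
  qed
  have upper: "Lp_norm M p f \<le> p * S" if "p \<ge> 1" for p
  proof -
    have "Lp_norm M p f / p \<le> S"
      unfolding S_def using that by (intro cSUP_upper bdd) auto
    then show ?thesis using that by (simp add: field_simps)
  qed
  have "0 \<le> Lp_norm M 1 f" by (simp add: Lp_norm_def)
  then show S0: "0 \<le> S" using upper[of 1] by simp
  show "(\<integral>\<^sup>+ x. ennreal (h x ^ k) \<partial>M) \<le> ennreal ((real k * S) ^ k)" if "k \<ge> 1"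
  proof -
    have k: "real k \<ge> 1" using that by simp
    have "(\<integral>\<^sup>+ x. ennreal (h x ^ k) \<partial>M) \<le> T k"
      unfolding T_def using h f0 that
      by (intro nn_integral_mono ennreal_leI) (auto simp: powr_realpow' intro: power_mono)
    also have "T k = ennreal (enn2real (T k))"
      using T_le[OF k] by (metis ennreal_enn2real ennreal_less_top le_less_trans)
    also have "\<dots> \<le> ennreal ((real k * S) ^ k)"
    proof (rule ennreal_leI)
      have "enn2real (T k) = (enn2real (T k) powr (1 / k)) powr k"
        using k by (simp add: powr_powr)
      also have "\<dots> = Lp_norm M k f powr k"
        by (simp add: Lp_norm_def T_def)
      also have "\<dots> \<le> (real k * S) powr k"
        using upper[OF k] k by (intro powr_mono2) (auto simp: Lp_norm_def)
      also have "\<dots> = (real k * S) ^ k"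
        using S0 that by (simp add: powr_realpow')
      finally show "enn2real (T k) \<le> (real k * S) ^ k" .
    qed
    finally show ?thesis .
  qed
qed

section \<open>Densities on product spaces and the choice of constants\<close>

text \<open>A finite product measure is determined by its values on boxes, where density and
  indicator both split into one-variable factors.\<close>

lemma (in prob_space) PiM_density:
  fixes g :: "'a \<Rightarrow> ennreal"
  assumes I: "finite I" and [measurable]: "g \<in> borel_measurable M" and "prob_space (density M g)"
  shows "Pi\<^sub>M I (\<lambda>_. density M g) = density (Pi\<^sub>M I (\<lambda>_. M)) (\<lambda>X. \<Prod>i\<in>I. g (X i))"
proof -
  interpret D: prob_space "density M g" by fact
  interpret product_sigma_finite "\<lambda>_. density M g" by standard
  have "density (Pi\<^sub>M I (\<lambda>_. M)) (\<lambda>X. \<Prod>i\<in>I. g (X i)) = Pi\<^sub>M I (\<lambda>_. density M g)"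
  proof (rule PiM_eqI[OF I])
    show "sets (density (Pi\<^sub>M I (\<lambda>_. M)) (\<lambda>X. \<Prod>i\<in>I. g (X i))) = sets (Pi\<^sub>M I (\<lambda>_. density M g))"
      by (simp cong: sets_PiM_cong)
    fix A assume "\<And>i. i \<in> I \<Longrightarrow> A i \<in> sets (density M g)"
    then have A[measurable]: "\<And>i. i \<in> I \<Longrightarrow> A i \<in> sets M" by simp
    have "emeasure (density (Pi\<^sub>M I (\<lambda>_. M)) (\<lambda>X. \<Prod>i\<in>I. g (X i))) (Pi\<^sub>E I A)
        = (\<integral>\<^sup>+ X. (\<Prod>i\<in>I. g (X i)) * indicator (Pi\<^sub>E I A) X \<partial>Pi\<^sub>M I (\<lambda>_. M))"
      using I A by (intro emeasure_density sets_PiM_I_finite) auto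
    also have "\<dots> = (\<integral>\<^sup>+ X. (\<Prod>i\<in>I. g (X i) * indicator (A i) (X i)) \<partial>Pi\<^sub>M I (\<lambda>_. M))"
    proof (rule nn_integral_cong)
      fix X assume "X \<in> space (Pi\<^sub>M I (\<lambda>_. M))"
      then have "X \<in> extensional I" by (auto simp: space_PiM PiE_def)
      then have "indicator (Pi\<^sub>E I A) X = (\<Prod>i\<in>I. indicator (A i) (X i) :: ennreal)"
        using I by (auto simp: indicator_def PiE_def Pi_def prod_zero_iff)
      then show "(\<Prod>i\<in>I. g (X i)) * indicator (Pi\<^sub>E I A) X = (\<Prod>i\<in>I. g (X i) * indicator (A i) (X i))"
        by (simp add: prod.distrib)
    qed
    also have "\<dots> = (\<Prod>i\<in>I. \<integral>\<^sup>+ x. g x * indicator (A i) x \<partial>M)"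
      using I A by (intro nn_integral_PiM_prod) auto
    also have "\<dots> = (\<Prod>i\<in>I. emeasure (density M g) (A i))"
      using A by (intro prod.cong refl) (simp add: emeasure_density)
    finally show "emeasure (density (Pi\<^sub>M I (\<lambda>_. M)) (\<lambda>X. \<Prod>i\<in>I. g (X i))) (Pi\<^sub>E I A)
        = (\<Prod>i\<in>I. emeasure (density M g) (A i))" .
  qed
  then show ?thesis ..
qed

text \<open>Nonnegativity of \<open>\<rho>\<close> holds only almost everywhere, so the truncation
  by \<open>ennreal\<close> is moved into the product off a null set of the product space.\<close>

lemma (in prob_space) nn_integral_PiM_density:
  fixes \<rho> :: "'a \<Rightarrow> real" and F :: "('i \<Rightarrow> 'a) \<Rightarrow> real"
  assumes I: "finite I" and [measurable]: "\<rho> \<in> borel_measurable M" and \<rho>: "AE x in M. 0 \<le> \<rho> x"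
    and "prob_space (density M \<rho>)"
    and [measurable]: "F \<in> borel_measurable (Pi\<^sub>M I (\<lambda>_. M))"
  shows "(\<integral>\<^sup>+ X. ennreal ((\<Prod>i\<in>I. \<rho> (X i)) * F X) \<partial>Pi\<^sub>M I (\<lambda>_. M))
    = (\<integral>\<^sup>+ X. ennreal (F X) \<partial>Pi\<^sub>M I (\<lambda>_. density M \<rho>))"
proof -
  have "AE X in Pi\<^sub>M I (\<lambda>_. M). \<forall>i\<in>I. 0 \<le> \<rho> (X i)"
    unfolding AE_finite_all[OF I]
    using AE_PiM_component[of I "\<lambda>_. M" _ "\<lambda>x. 0 \<le> \<rho> x"] \<rho> prob_space_axioms by blast
  then have "AE X in Pi\<^sub>M I (\<lambda>_. M).
      ennreal ((\<Prod>i\<in>I. \<rho> (X i)) * F X) = (\<Prod>i\<in>I. ennreal (\<rho> (X i))) * ennreal (F X)"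
    by eventually_elim (simp add: ennreal_mult' prod_ennreal prod_nonneg)
  then have "(\<integral>\<^sup>+ X. ennreal ((\<Prod>i\<in>I. \<rho> (X i)) * F X) \<partial>Pi\<^sub>M I (\<lambda>_. M))
      = (\<integral>\<^sup>+ X. (\<Prod>i\<in>I. ennreal (\<rho> (X i))) * ennreal (F X) \<partial>Pi\<^sub>M I (\<lambda>_. M))"
    by (rule nn_integral_cong_AE)
  also have "\<dots> = (\<integral>\<^sup>+ X. ennreal (F X) \<partial>density (Pi\<^sub>M I (\<lambda>_. M)) (\<lambda>X. \<Prod>i\<in>I. ennreal (\<rho> (X i))))"
    by (rule nn_integral_density[symmetric]) measurable
  finally show ?thesis
    using assms by (simp add: PiM_density)
qed

lemma (in prob_space) nn_integral_exp_pair_interaction_le_of_SUP_Lp_norm: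
  fixes \<phi> :: "'a \<Rightarrow> 'a \<Rightarrow> real" and N :: nat
  assumes \<phi>: "(\<lambda>(x, z). \<phi> x z) \<in> borel_measurable (M \<Otimes>\<^sub>M M)"
    and B: "\<And>x z. x \<in> space M \<Longrightarrow> z \<in> space M \<Longrightarrow> \<bar>\<phi> x z\<bar> \<le> B"
    and mean1: "\<And>z. z \<in> space M \<Longrightarrow> (\<integral>x. \<phi> x z \<partial>M) = 0"
    and mean2: "\<And>x. x \<in> space M \<Longrightarrow> (\<integral>z. \<phi> x z \<partial>M) = 0"
    and small: "240 * (SUP p\<in>{1..}. Lp_norm M p (\<lambda>x. SUP z\<in>space M. \<bar>\<phi> x z\<bar>) / p) \<le> 1"
    and N: "N \<ge> 1"
  shows "(\<integral>\<^sup>+ X. ennreal (exp (1 / N * (\<Sum>i<N. \<Sum>j<N. \<phi> (X i) (X j)))) \<partial>Pi\<^sub>M {..<N} (\<lambda>_. M)) \<le> 2"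
proof -
  define f where "f = (\<lambda>x. SUP z\<in>space M. \<bar>\<phi> x z\<bar>)"
  have f_le: "f x \<le> B" if "x \<in> space M" for x
    unfolding f_def using B[OF that] not_empty by (intro cSUP_least) auto
  \<comment> \<open>The exponent 40 is 8 from the Taylor remainder plus 32 to absorb the factor
    \<open>(K x)\<^sup>2\<close>; the moment criterion asks for \<open>6 * 40 * S \<le> 1\<close>,
    whence 240.\<close>
  have exp40: "(\<integral>\<^sup>+ x. ennreal (exp (40 * h x)) \<partial>M) \<le> 2"
    if h: "random_variable borel h" "\<And>x. x \<in> space M \<Longrightarrow> 0 \<le> h x" "\<And>x. x \<in> space M \<Longrightarrow> h x \<le> f x" for h
    using nn_integral_power_le_of_SUP_Lp_norm[OF f_le h(2,3)] small
    by (intro nn_integral_exp_le_of_moments[OF h(1,2)]) (auto simp: f_def)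
  obtain G where G: "random_variable borel G" "\<And>x. x \<in> space M \<Longrightarrow> 0 \<le> G x"
    "\<And>x. x \<in> space M \<Longrightarrow> G x \<le> f x" "\<And>x. x \<in> space M \<Longrightarrow> AE z in M. \<bar>\<phi> x z\<bar> \<le> G x"
    unfolding f_def by (rule measurable_ess_sup_section[OF \<phi> B]) blast+
  note [measurable] = G(1)
  \<comment> \<open>The shift keeps \<open>K\<close> away from zero and costs only
    \<open>exp (40 * (1 / 40)) = exp 1 \<le> 3\<close>.\<close>
  define K where "K = (\<lambda>x. G x + 1 / 40)"
  have [measurable]: "random_variable borel K" unfolding K_def by measurable
  have diag_meas: "random_variable borel (\<lambda>x. \<phi> x x)"
    using measurable_compose[OF measurable_Pair[OF measurable_ident measurable_ident] \<phi>] by simp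
  \<comment> \<open>The essential bound \<open>G\<close> says nothing on the diagonal, which may be
    a null set; there the pointwise supremum \<open>f\<close> is used instead.\<close>
  have diag_le: "\<bar>\<phi> x x\<bar> \<le> f x" if "x \<in> space M" for x
    unfolding f_def using that B[OF that] by (intro cSUP_upper) (auto intro!: bdd_aboveI)
  show ?thesis
  proof (rule nn_integral_exp_pair_interaction_le[where K = K and \<epsilon> = "1 / 40", OF \<phi> B _ _ _ _ mean1 mean2 _ _ N])
    show "1 / 40 \<le> K x" if "x \<in> space M" for x
      using G(2)[OF that] by (simp add: K_def)
    show "AE z in M. \<bar>\<phi> x z\<bar> \<le> K x" if "x \<in> space M" for x
      using G(4)[OF that] by eventually_elim (simp add: K_def)
    have "(\<integral>\<^sup>+ x. ennreal (32 * (K x)\<^sup>2 * exp (8 * K x)) \<partial>M) \<le> (\<integral>\<^sup>+ x. ennreal (3 / 16) * ennreal (exp (40 * G x)) \<partial>M)"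
    proof (rule nn_integral_mono)
      fix x assume x: "x \<in> space M"
      have K0: "K x \<ge> 0" using G(2)[OF x] by (simp add: K_def)
      \<comment> \<open>The quadratic term of \<open>exp\<close> at \<open>32 * K x\<close>. It
        gives \<open>32 * (K x)\<^sup>2 \<le> exp (32 * K x) / 16\<close>, and with
        \<open>exp 1 \<le> 3\<close> and the integral bound 2 the total is
        \<open>3 / 16 * 2 = 3 / 8\<close>.\<close>
      have "512 * (K x)\<^sup>2 \<le> exp (32 * K x)"
        using exp_lower_Taylor_quadratic[of "32 * K x"] K0 by (simp add: power_mult_distrib)
      then have "32 * (K x)\<^sup>2 * exp (8 * K x) \<le> (exp (32 * K x) / 16) * exp (8 * K x)"
        by (intro mult_right_mono) auto
      also have "\<dots> = exp (40 * K x) / 16"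
        by (simp flip: exp_add)
      also have "\<dots> = exp 1 * exp (40 * G x) / 16"
        by (simp add: K_def algebra_simps flip: exp_add)
      also have "\<dots> \<le> 3 * exp (40 * G x) / 16"
        using exp_le by (intro divide_right_mono mult_right_mono) auto
      finally show "ennreal (32 * (K x)\<^sup>2 * exp (8 * K x)) \<le> ennreal (3 / 16) * ennreal (exp (40 * G x))"
        by (simp add: ennreal_leI flip: ennreal_mult)
    qed
    also have "\<dots> = ennreal (3 / 16) * (\<integral>\<^sup>+ x. ennreal (exp (40 * G x)) \<partial>M)"
      by (rule nn_integral_cmult) measurable
    also have "\<dots> \<le> ennreal (3 / 16) * ennreal 2"
      using exp40[OF G(1-3)] by (intro mult_left_mono) auto
    also have "\<dots> = ennreal (3 / 8)"
      by (subst ennreal_mult[symmetric]) auto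
    finally show "(\<integral>\<^sup>+ x. ennreal (32 * (K x)\<^sup>2 * exp (8 * K x)) \<partial>M) \<le> ennreal (3 / 8)" .
    have "(\<integral>\<^sup>+ x. ennreal (exp (2 * \<phi> x x)) \<partial>M) \<le> (\<integral>\<^sup>+ x. ennreal (exp (40 * \<bar>\<phi> x x\<bar>)) \<partial>M)"
      by (intro nn_integral_mono ennreal_leI) auto
    also have "\<dots> \<le> 2"
      using diag_meas diag_le by (intro exp40) auto
    finally show "(\<integral>\<^sup>+ x. ennreal (exp (2 * \<phi> x x)) \<partial>M) \<le> 2" .
  qed auto
qed

theorem theorem4:
  "\<exists>C::real. C > 0 \<and>
    (\<forall>(d::nat) (\<rho> :: (nat \<Rightarrow> circle) \<Rightarrow> real)
      (\<phi> :: (nat \<Rightarrow> circle) \<Rightarrow> (nat \<Rightarrow> circle) \<Rightarrow> real) (\<gamma>::real).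
      integrable (torus d) \<rho> \<longrightarrow>
      (AE x in torus d. 0 \<le> \<rho> x) \<longrightarrow>
      (LINT x|torus d. \<rho> x) = 1 \<longrightarrow>
      (\<lambda>(x, z). \<phi> x z) \<in> borel_measurable (torus d \<Otimes>\<^sub>M torus d) \<longrightarrow>
      (\<exists>B. \<forall>x \<in> space (torus d). \<forall>z \<in> space (torus d). \<bar>\<phi> x z\<bar> \<le> B) \<longrightarrow>
      \<gamma> = C * (SUP p\<in>{1..}.
                 Lp_norm (density (torus d) (\<lambda>x. ennreal (\<rho> x))) p
                   (\<lambda>x. SUP z\<in>space (torus d). \<bar>\<phi> x z\<bar>) / p)\<^sup>2 \<longrightarrow>
      \<gamma> < 1 \<longrightarrow>
      (\<forall>z \<in> space (torus d). (LINT x|torus d. \<phi> x z * \<rho> x) = 0) \<longrightarrow>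
      (\<forall>x \<in> space (torus d). (LINT z|torus d. \<phi> x z * \<rho> z) = 0) \<longrightarrow>
      (\<forall>N::nat. N \<ge> 1 \<longrightarrow>
        (\<integral>\<^sup>+ X. ennreal ((\<Prod>i<N. \<rho> (X i)) *
              exp (1 / real N * (\<Sum>i<N. \<Sum>j<N. \<phi> (X i) (X j))))
            \<partial>(Pi\<^sub>M {..<N} (\<lambda>_. torus d))) \<le> ennreal (2 / (1 - \<gamma>)) \<and>
        ennreal (2 / (1 - \<gamma>)) < \<infinity>))"
proof (intro exI[of _ "240\<^sup>2"] conjI allI impI)
  fix d :: nat and \<rho> :: "(nat \<Rightarrow> circle) \<Rightarrow> real"
    and \<phi> :: "(nat \<Rightarrow> circle) \<Rightarrow> (nat \<Rightarrow> circle) \<Rightarrow> real" and \<gamma> :: real and N :: nat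
  assume \<rho>: "integrable (torus d) \<rho>" "AE x in torus d. 0 \<le> \<rho> x" "(LINT x|torus d. \<rho> x) = 1"
    and \<phi>[measurable]: "(\<lambda>(x, z). \<phi> x z) \<in> borel_measurable (torus d \<Otimes>\<^sub>M torus d)"
    and "\<exists>B. \<forall>x \<in> space (torus d). \<forall>z \<in> space (torus d). \<bar>\<phi> x z\<bar> \<le> B"
    and \<gamma>: "\<gamma> = 240\<^sup>2 * (SUP p\<in>{1..}. Lp_norm (density (torus d) (\<lambda>x. ennreal (\<rho> x))) p
        (\<lambda>x. SUP z\<in>space (torus d). \<bar>\<phi> x z\<bar>) / p)\<^sup>2" "\<gamma> < 1"
    and mean1: "\<forall>z \<in> space (torus d). (LINT x|torus d. \<phi> x z * \<rho> x) = 0"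
    and mean2: "\<forall>x \<in> space (torus d). (LINT z|torus d. \<phi> x z * \<rho> z) = 0"
    and N: "N \<ge> 1"
  then obtain B where B: "\<And>x z. x \<in> space (torus d) \<Longrightarrow> z \<in> space (torus d) \<Longrightarrow> \<bar>\<phi> x z\<bar> \<le> B" by blast
  interpret T: prob_space "torus d" by (rule prob_space_torus)
  have [measurable]: "\<rho> \<in> borel_measurable (torus d)" using \<rho>(1) by auto
  \<comment> \<open>From here on the density is absorbed into the probability measure, so both
    cancellations become plain centering under \<open>\<mu>\<close>.\<close>
  define \<mu> where "\<mu> = density (torus d) (\<lambda>x. ennreal (\<rho> x))"
  have sp[simp]: "space \<mu> = space (torus d)" and se[measurable_cong]: "sets \<mu> = sets (torus d)"
    by (simp_all add: \<mu>_def)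
  have prob: "prob_space \<mu>"
    using nn_integral_eq_integral[OF \<rho>(1,2)] \<rho>(3)
    by (intro prob_spaceI) (simp add: \<mu>_def emeasure_density cong: nn_integral_cong)
  have \<phi>m[measurable (raw)]: "(\<lambda>w. \<phi> (f w) (g w)) \<in> borel_measurable L"
    if "f \<in> measurable L (torus d)" "g \<in> measurable L (torus d)" for L :: "'c measure" and f g
    using measurable_compose[OF measurable_Pair[OF that] \<phi>] by simp
  have m1: "(LINT x|\<mu>. \<phi> x z) = 0" if [measurable]: "z \<in> space (torus d)" for z
    using mean1 that \<rho>(2) by (simp add: \<mu>_def integral_density mult.commute)
  have m2: "(LINT z|\<mu>. \<phi> x z) = 0" if [measurable]: "x \<in> space (torus d)" for x
    using mean2 that \<rho>(2) by (simp add: \<mu>_def integral_density mult.commute)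
  define S where "S = (SUP p\<in>{1..}. Lp_norm \<mu> p (\<lambda>x. SUP z\<in>space \<mu>. \<bar>\<phi> x z\<bar>) / p)"
  \<comment> \<open>The constant \<open>240\<^sup>2\<close> makes \<open>\<gamma> < 1\<close> say
    exactly that \<open>240 * S\<close> has modulus below 1. The square also gives
    \<open>0 \<le> \<gamma>\<close>, so that \<open>2 \<le> 2 / (1 - \<gamma>)\<close> at the
    end.\<close>
  have \<gamma>S: "\<gamma> = (240 * S)\<^sup>2"
    using \<gamma>(1) by (simp add: S_def \<mu>_def power_mult_distrib)
  then have "(240 * S)\<^sup>2 < 1\<^sup>2" using \<gamma>(2) by simp
  then have small: "240 * S \<le> 1"
    by (meson less_imp_le power2_less_imp_less zero_le_one)
  have "(\<integral>\<^sup>+ X. ennreal ((\<Prod>i<N. \<rho> (X i)) * exp (1 / real N * (\<Sum>i<N. \<Sum>j<N. \<phi> (X i) (X j))))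
        \<partial>(Pi\<^sub>M {..<N} (\<lambda>_. torus d)))
      = (\<integral>\<^sup>+ X. ennreal (exp (1 / real N * (\<Sum>i<N. \<Sum>j<N. \<phi> (X i) (X j)))) \<partial>(Pi\<^sub>M {..<N} (\<lambda>_. \<mu>)))"
    unfolding \<mu>_def using \<rho>(2) prob by (intro T.nn_integral_PiM_density) (auto simp: \<mu>_def)
  also have "\<dots> \<le> 2"
    using B m1 m2 small N unfolding S_def
    by (intro prob_space.nn_integral_exp_pair_interaction_le_of_SUP_Lp_norm[OF prob]) auto
  also have "(2 :: ennreal) = ennreal 2" by simp
  also have "\<dots> \<le> ennreal (2 / (1 - \<gamma>))"
    using \<gamma>S \<gamma>(2) by (intro ennreal_leI) (simp add: field_simps)
  finally show "(\<integral>\<^sup>+ X. ennreal ((\<Prod>i<N. \<rho> (X i)) * exp (1 / real N * (\<Sum>i<N. \<Sum>j<N. \<phi> (X i) (X j))))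
        \<partial>(Pi\<^sub>M {..<N} (\<lambda>_. torus d))) \<le> ennreal (2 / (1 - \<gamma>))" .
qed auto

end
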